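(* Let $n=2t$ with $t\geq 3$, let $q$ be an odd prime power and let $\sigma$ be a generator of $\mathrm{Gal}(\mathbb{F}_{q^n}/\mathbb{F}_q)$. For any $h\in\mathbb{F}_{q^n}$ such that $\mathrm{N}_{q^n/q^t}(h)=-1$, the rank-metric code $$\mathcal{C}_{h,t,\sigma}=\langle x,\psi_{h,t,\sigma}(x)\rangle_{\mathbb{F}_{q^n}},$$ with $$\psi_{h,t,\sigma}(x)=x^{\sigma}+x^{\sigma^{t-1}}+h\sigma(h)x^{\sigma^{t+1}}+h\sigma^{-1}(h^{-1})x^{\sigma^{2t-1}},$$ is an MRD code.
   Context: $\mathrm{N}_{q^n/q^t}(h)=h^{q^t+1}=h\,\sigma^t(h)$ is the norm from $\mathbb{F}_{q^n}$ to $\mathbb{F}_{q^t}$. For a generator $\sigma$ of $\mathrm{Gal}(\mathbb{F}_{q^n}/\mathbb{F}_q)$, $\mathcal{L}_{n,q}$ denotes the ring of $\sigma$-polynomials $f(x)=\sum_{i=0}^{n-1}f_ix^{\sigma^i}$, $f_i\in\mathbb{F}_{q^n}$, each identified with the $\mathbb{F}_q$-endomorphism $\alpha\mapsto\sum_i f_i\sigma^i(\alpha)$ of $\mathbb{F}_{q^n}$; this identifies $\mathcal{L}_{n,q}$ with $\mathrm{End}_{\mathbb{F}_q}(\mathbb{F}_{q^n})$, independently of $\sigma$. The rank $\mathrm{rk}(f)$ is the $\mathbb{F}_q$-rank of this endomorphism, and $\langle\cdot\rangle_{\mathbb{F}_{q^n}}$ denotes the span with respect to left multiplication by scalars of $\mathbb{F}_{q^n}$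 (i.e. multiplying all coefficients). A rank-metric code is a subset $\mathcal{C}\subseteq\mathcal{L}_{n,q}$; its minimum distance is $d(\mathcal{C})=\min\{\mathrm{rk}(f-g):f,g\in\mathcal{C},f\neq g\}$. The code $\mathcal{C}$ is a maximum rank distance (MRD) code if $|\mathcal{C}|=q^{n(n-d(\mathcal{C})+1)}$. *)

theory Defs
  imports
    "HOL-Algebra.Generated_Groups"
    "HOL-Library.Function_Algebras"
    "HOL-Library.Cardinality"
    "HOL-Number_Theory.Prime_Powers"
begin

text \<open>
  An extension of finite fields is given by two field types 'k (the small field) and 'a (the large
  field) together with an embedding \<open>\<phi> :: 'k \<Rightarrow> 'a\<close>.
\<close>

definition field_hom :: "('k::field \<Rightarrow> 'a::field) \<Rightarrow> bool" where
  "field_hom f \<longleftrightarrow>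
     (\<forall>x y. f (x + y) = f x + f y) \<and> (\<forall>x y. f (x * y) = f x * f y) \<and> f 1 = 1"

definition galois_group :: "('k::field \<Rightarrow> 'a::field) \<Rightarrow> ('a \<Rightarrow> 'a) monoid" where
  "galois_group \<phi> =
     \<lparr>carrier = {\<tau>. field_hom \<tau> \<and> bij \<tau> \<and> (\<forall>c. \<tau> (\<phi> c) = \<phi> c)}, monoid.mult = (\<circ>), one = id\<rparr>"

definition galois_generator :: "('k::field \<Rightarrow> 'a::field) \<Rightarrow> ('a \<Rightarrow> 'a) \<Rightarrow> bool" where
  "galois_generator \<phi> \<sigma> \<longleftrightarrow>
     \<sigma> \<in> carrier (galois_group \<phi>) \<and> generate (galois_group \<phi>) {\<sigma>} = carrier (galois_group \<phi>)"

text \<open>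
  A \<open>\<sigma>\<close>-polynomial is identified with the map it induces; differences of maps are pointwise.
\<close>

definition sigma_polys :: "('a::field \<Rightarrow> 'a) \<Rightarrow> nat \<Rightarrow> ('a \<Rightarrow> 'a) set" where
  "sigma_polys \<sigma> n = {(\<lambda>x. \<Sum>i<n. c i * (\<sigma> ^^ i) x) |c. True}"

definition rk :: "('k::field \<Rightarrow> 'a::field) \<Rightarrow> ('a \<Rightarrow> 'a) \<Rightarrow> nat" where
  "rk \<phi> f = vector_space.dim (\<lambda>c x. \<phi> c * x) (range f)"

text \<open>
  The minimum is over a finite set as soon as 'a is finite, and over a nonempty one as soon as
  the code has two elements; otherwise it carries no information.
\<close>

definition min_distance :: "('k::field \<Rightarrow> 'a::field) \<Rightarrow> ('a \<Rightarrow> 'a) set \<Rightarrow> nat" where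
  "min_distance \<phi> C = Min {rk \<phi> (f - g) |f g. f \<in> C \<and> g \<in> C \<and> f \<noteq> g}"

text \<open>
  Here \<open>n\<close> is the degree of the extension; elements of \<open>sigma_polys \<sigma> n\<close> have rank at most \<open>n\<close>,
  so the subtraction does not truncate.
\<close>

definition MRD_code ::
    "('k::field \<Rightarrow> 'a::field) \<Rightarrow> ('a \<Rightarrow> 'a) \<Rightarrow> nat \<Rightarrow> ('a \<Rightarrow> 'a) set \<Rightarrow> bool" where
  "MRD_code \<phi> \<sigma> n C \<longleftrightarrow>
     C \<subseteq> sigma_polys \<sigma> n \<and> card C = CARD('k) ^ (n * (n - min_distance \<phi> C + 1))"

definition rel_norm :: "nat \<Rightarrow> nat \<Rightarrow> 'a::field \<Rightarrow> 'a" where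
  "rel_norm q t h = h ^ (q ^ t + 1)"

definition psi :: "'a::field \<Rightarrow> nat \<Rightarrow> ('a \<Rightarrow> 'a) \<Rightarrow> 'a \<Rightarrow> 'a" where
  "psi h t \<sigma> x =
     \<sigma> x + (\<sigma> ^^ (t - 1)) x + h * \<sigma> h * (\<sigma> ^^ (t + 1)) x
       + h * inv_into UNIV \<sigma> (inverse h) * (\<sigma> ^^ (2 * t - 1)) x"

definition psi_code :: "'a::field \<Rightarrow> nat \<Rightarrow> ('a \<Rightarrow> 'a) \<Rightarrow> ('a \<Rightarrow> 'a) set" where
  "psi_code h t \<sigma> = module.span (\<lambda>a f x. a * f x) {\<lambda>x. x, psi h t \<sigma>}"

end

(*
  Write bar = sigma^t and tau = sigma^-1, so that h * bar h = -1. The code is MRD iff psi is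
  scattered, i.e. x * psi y = y * psi x with x <> 0 forces y / x into the small field. Now psi is the
  sum of a sigma-semilinear and a tau-semilinear map of rank one over the fixed field of bar, with
  complementary kernels. Splitting x = x1 + x2 and y = y1 + y2 along these kernels, the terms of
  x * psi y - y * psi x fall into three lines over that fixed field, which relates them by two linear
  equations. They say that a certain multiple g of d = x2 * tau y1 - y2 * tau x1 satisfies
  sigma g = g, whereas bar g = -g, so d = 0. What remains gives either sigma (y / x) = y / x or an
  element g with g * sigma g = -1 and bar g = -g, which is impossible in odd characteristic.
*)
theory Submission
  imports Defs "HOL-Number_Theory.Residues" "HOL-Algebra.Algebraic_Closure_Type"
begin

subsection \<open>The scattered property\<close>

lemma field_hom_simps:
  assumes "field_hom f"
  shows "f (x + y) = f x + f y" "f (x * y) = f x * f y" "f 1 = 1" "f 0 = 0"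
    "f (- x) = - f x" "f (x - y) = f x - f y" "f (inverse x) = inverse (f x)"
    "f (x / y) = f x / f y" "f x = 0 \<longleftrightarrow> x = 0"
proof -
  show add: "f (x + y) = f x + f y" for x y
    using assms by (simp add: field_hom_def)
  show mult: "f (x * y) = f x * f y" for x y
    using assms by (simp add: field_hom_def)
  show one: "f 1 = 1"
    using assms by (simp add: field_hom_def)
  show zero: "f 0 = 0" using add[of 0 0] by (metis add.right_neutral add_cancel_right_right)
  show minus: "f (- x) = - f x" for x
    using add[of x "- x"] zero by (simp add: eq_neg_iff_add_eq_0 add.commute)
  show "f (x - y) = f x - f y" for x y
    using add[of x "- y"] minus by simp
  show eq0: "f x = 0 \<longleftrightarrow> x = 0" for x
  proof
    assume "f x = 0"
    show "x = 0"
    proof (rule ccontr)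
      assume "x \<noteq> 0"
      with mult[of x "inverse x"] one \<open>f x = 0\<close> show False by simp
    qed
  qed (simp add: zero)
  show inv: "f (inverse x) = inverse (f x)" for x
  proof (cases "x = 0")
    case False
    with mult[of x "inverse x"] one have "f x * f (inverse x) = 1" by simp
    then show ?thesis by (rule inverse_unique[symmetric])
  qed (simp add: zero)
  show "f (x / y) = f x / f y"
    by (simp add: divide_inverse mult inv)
qed

lemma field_hom_funpow: "field_hom (f :: 'a::field \<Rightarrow> 'a) \<Longrightarrow> field_hom (f ^^ k)"
  by (induction k) (auto simp: field_hom_def)

text \<open>These are the facts about the finite field from which the scattered property is derived:
  \<sigma>^t is the conjugation over the field with q^t elements, \<open>h_bar\<close> is the norm
  condition and \<open>two\<close> expresses odd characteristic.\<close>

locale involution_setup =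
  fixes \<sigma> \<tau> :: "'a::field \<Rightarrow> 'a" and t :: nat and h :: 'a
  assumes hom: "field_hom \<sigma>"
    and \<sigma>_\<tau>: "\<sigma> (\<tau> x) = x" and \<tau>_\<sigma>: "\<tau> (\<sigma> x) = x"
    and bar_bar: "(\<sigma> ^^ t) ((\<sigma> ^^ t) x) = x"
    and h_bar: "h * (\<sigma> ^^ t) h = - 1"
    and two: "(1::'a) \<noteq> - 1"
begin

abbreviation bar :: "'a \<Rightarrow> 'a" where "bar \<equiv> \<sigma> ^^ t"

lemma neg_eq_self: "x = - x \<longleftrightarrow> x = 0" for x :: 'a
proof
  assume "x = - x"
  then have "x * (1 - - 1) = 0" by (simp add: algebra_simps eq_neg_iff_add_eq_0)
  then show "x = 0" using two by auto
qed simp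

lemma hom_\<tau>: "field_hom \<tau>"
  using hom unfolding field_hom_def by (metis \<sigma>_\<tau> \<tau>_\<sigma>)

lemmas \<sigma>_simps = field_hom_simps[OF hom]
lemmas \<tau>_simps = field_hom_simps[OF hom_\<tau>]
lemmas bar_simps = field_hom_simps[OF field_hom_funpow[OF hom, of t]]

lemma bar_\<sigma>: "bar (\<sigma> x) = \<sigma> (bar x)"
  by (simp add: funpow_swap1)

lemma bar_\<tau>: "bar (\<tau> x) = \<tau> (bar x)"
  by (metis bar_\<sigma> \<sigma>_\<tau> \<tau>_\<sigma>)

lemma bar_parity:
  assumes "\<sigma> (\<sigma> x) = x"
  shows "bar x = (if even t then x else \<sigma> x)"
proof -
  have "(\<sigma> ^^ (2 * r)) x = x" for r
    by (induction r) (simp_all add: assms)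
  moreover have "(\<sigma> ^^ Suc (2 * r)) x = \<sigma> x" for r
    using calculation[of r] by simp
  ultimately show ?thesis
    by (auto elim!: evenE oddE simp del: funpow.simps)
qed

lemma bar_fixed: "\<sigma> x = x \<Longrightarrow> bar x = x"
  by (simp add: bar_parity)

text \<open>The first equation gives \<sigma>^2 g = g, so by \<open>bar_parity\<close> the value -g
  of \<sigma>^t g is g or \<sigma> g; odd characteristic leaves \<sigma> g = -g. Then g^2 = 1, so g
  is 1 or -1 and fixed by \<sigma>, a contradiction.\<close>

lemma no_skew_norm:
  assumes "g * \<sigma> g = - 1" and "bar g = - g"
  shows False
proof -
  have g0: "g \<noteq> 0" using assms by auto
  have \<sigma>g: "\<sigma> g = - 1 / g" using assms(1) g0 by (simp add: field_simps)
  then have "\<sigma> (\<sigma> g) = g" using g0 by (simp add: \<sigma>_simps)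
  with bar_parity assms(2) g0 neg_eq_self have "\<sigma> g = - g" by (metis)
  moreover from this \<sigma>g g0 have "g * g = 1" by (simp add: field_simps)
  then have "g = 1 \<or> g = - 1" by (simp add: square_eq_1_iff)
  then have "\<sigma> g = g" by (auto simp: \<sigma>_simps)
  ultimately show False using g0 neg_eq_self by metis
qed

lemma h_nz: "h \<noteq> 0"
  using h_bar by auto

text \<open>Keeps \<open>u\<close>, \<open>v\<close> and c2 - c1 in \<open>scattered\<close>
  nonzero. Otherwise \<sigma>^2 swaps h and 1/h. Comparing with \<sigma>^t h = -1/h gives \<sigma>^2
  h = h for either parity of t, hence h^2 = 1. For even t this contradicts h^2 = -1; for odd t, h is
  fixed by \<sigma> although \<sigma> h is -1/h or -h.\<close>

lemma h_\<sigma>\<sigma>h: "h * \<sigma> (\<sigma> h) \<noteq> 1"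
proof
  assume *: "h * \<sigma> (\<sigma> h) = 1"
  have bh: "bar h = - 1 / h" using h_bar h_nz by (simp add: field_simps)
  have s2: "\<sigma> (\<sigma> h) = 1 / h" using * h_nz by (simp add: field_simps)
  then have s4: "\<sigma> (\<sigma> (1 / h)) = h" using h_nz by (simp add: \<sigma>_simps)
  have even_pow: "(\<sigma> ^^ (2 * r)) h = (if even r then h else 1 / h)" for r
    by (induction r) (simp_all add: s2 s4)
  have sq1: "h = 1 \<or> h = - 1" if "1 / h = h"
    using that h_nz by (simp add: field_simps square_eq_1_iff)
  have fixed: "\<sigma> h = h" if "h = 1 \<or> h = - 1" using that by (auto simp: \<sigma>_simps)
  show False
  proof (cases "even t")
    case True
    then obtain r where "t = 2 * r" by (elim evenE)
    with bh even_pow[of r] have "h = - 1 / h \<or> 1 / h = - (1 / h)" by (auto split: if_splits)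
    then have hh: "h * h = - 1" using h_nz neg_eq_self[of "1 / h"] by (auto simp: field_simps)
    then have "\<sigma> h * \<sigma> h = h * h" by (metis \<sigma>_simps(2,3,5))
    then have "\<sigma> h = h \<or> \<sigma> h = - h" by (simp add: square_eq_iff)
    then have "\<sigma> (\<sigma> h) = h" by (auto simp: \<sigma>_simps)
    with * hh two show False by simp
  next
    case False
    then obtain r where "t = Suc (2 * r)" by (auto elim: oddE)
    with bh even_pow[of r] have "\<sigma> h = - 1 / h \<or> \<sigma> (1 / h) = - 1 / h" by (auto split: if_splits)
    then have "\<sigma> h = - 1 / h \<or> \<sigma> h = - h" using h_nz
      by (auto simp: \<sigma>_simps field_simps) (metis minus_minus)
    then show False
    proof
      assume a: "\<sigma> h = - 1 / h"
      then have "\<sigma> (\<sigma> h) = h" using h_nz by (simp add: \<sigma>_simps)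
      with s2 sq1 have "h = 1 \<or> h = - 1" by simp
      with a fixed two show False by auto
    next
      assume a: "\<sigma> h = - h"
      then have "\<sigma> (\<sigma> h) = h" by (simp add: \<sigma>_simps)
      with s2 sq1 have "h = 1 \<or> h = - 1" by simp
      with a fixed h_nz neg_eq_self show False by metis
    qed
  qed
qed

text \<open>
  Since \<open>\<sigma>^t\<close> is an involution, \<open>\<sigma>^(t-1) = \<tau> bar\<close>, \<open>\<sigma>^(t+1) = \<sigma> bar\<close> and \<open>\<sigma>^(2t-1) = \<tau>\<close>.
\<close>
definition \<psi> :: "'a \<Rightarrow> 'a" where
  "\<psi> x = \<sigma> x + \<tau> (bar x) + h * \<sigma> h * \<sigma> (bar x) + h * \<tau> (inverse h) * \<tau> x"

lemma scattered:
  assumes x0: "x \<noteq> 0" and eq: "x * \<psi> y = y * \<psi> x"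
  shows "\<sigma> (y / x) = y / x"
proof -
  \<comment> \<open>\<sigma> raises the index by one and \<sigma>^t sends each k to -1/k, so that
    the identities below become rational ones in the k's.\<close>
  define k0 k1 k2 k3 k4 where k_def: "k0 = \<tau> (\<tau> h)" "k1 = \<tau> h" "k2 = h" "k3 = \<sigma> h" "k4 = \<sigma> (\<sigma> h)"
  have \<sigma>k: "\<sigma> k0 = k1" "\<sigma> k1 = k2" "\<sigma> k2 = k3" "\<sigma> k3 = k4"
    and \<tau>k: "\<tau> k1 = k0" "\<tau> k2 = k1" "\<tau> k3 = k2"
    by (simp_all add: k_def \<sigma>_\<tau> \<tau>_\<sigma>)
  have k_nz: "k0 \<noteq> 0" "k1 \<noteq> 0" "k2 \<noteq> 0" "k3 \<noteq> 0" "k4 \<noteq> 0"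
    using h_nz by (simp_all add: k_def \<sigma>_simps \<tau>_simps)
  have bh: "bar h = - 1 / h" using h_bar h_nz by (simp add: field_simps)
  have bk: "bar k0 = - 1 / k0" "bar k1 = - 1 / k1" "bar k2 = - 1 / k2" "bar k3 = - 1 / k3" "bar k4 = - 1 / k4"
    by (simp_all add: k_def bar_\<sigma> bar_\<tau> bh \<sigma>_simps \<tau>_simps)
  \<comment> \<open>One inequality and its images under \<tau>: \<open>k24\<close> makes v nonzero,
    \<open>k13\<close> separates c1 from c2, \<open>k02\<close> makes u nonzero.\<close>
  have k24: "k2 * k4 \<noteq> 1" using h_\<sigma>\<sigma>h by (simp add: k_def)
  have k13: "k1 * k3 \<noteq> 1" using k24 by (metis \<sigma>k \<sigma>_simps(2,3) \<tau>_\<sigma>)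
  have k02: "k0 * k2 \<noteq> 1" using k13 by (metis \<sigma>k \<sigma>_simps(2,3) \<tau>_\<sigma>)
  \<comment> \<open>The eigenspaces \<open>bar z = z / c1\<close> and \<open>bar z = z / c2\<close> are the kernels of
    \<open>z \<mapsto> \<sigma> z + h \<sigma> (h bar z)\<close> and \<open>z \<mapsto> \<tau> (bar z) + h \<tau> (z / h)\<close>.\<close>
  define c1 c2 where c_def: "c1 = - (k1 * k2)" "c2 = - (k2 / k3)"
  have c_nz: "c1 \<noteq> 0" "c2 \<noteq> 0" using k_nz by (simp_all add: c_def)
  have cc: "c2 \<noteq> c1" using k13 k_nz by (auto simp: c_def field_simps)
  have bc: "bar c1 = 1 / c1" "bar c2 = 1 / c2"
    using k_nz by (simp_all add: c_def bar_simps bk)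
  have decomp: "\<exists>z1 z2. z = z1 + z2 \<and> bar z1 = z1 / c1 \<and> bar z2 = z2 / c2" for z
  proof -
    \<comment> \<open>The solution of z = z1 + z2 and \<open>bar z\<close> = z1 / c1 + z2 / c2. Its
      parts are eigenvectors because \<open>bar\<close> inverts c1 and c2.\<close>
    define z1 z2 where z: "z1 = (c2 * bar z - z) * c1 / (c2 - c1)" "z2 = (z - c1 * bar z) * c2 / (c2 - c1)"
    have cb: "1 / c2 - 1 / c1 = (c1 - c2) / (c1 * c2)" using c_nz by (simp add: field_simps)
    have "z = z1 + z2" using cc c_nz unfolding z
      by (simp add: field_simps flip: add_divide_distrib)
    moreover have "bar z1 = z1 / c1" "bar z2 = z2 / c2"
      unfolding z bar_simps bc bar_bar cb using cc c_nz by (simp_all add: field_simps)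
    ultimately show ?thesis by blast
  qed
  obtain x1 x2 where x: "x = x1 + x2" and bx1: "bar x1 = x1 / c1" and bx2: "bar x2 = x2 / c2"
    using decomp by blast
  obtain y1 y2 where y: "y = y1 + y2" and by1: "bar y1 = y1 / c1" and by2: "bar y2 = y2 / c2"
    using decomp by blast
  define u v where uv: "u = 1 - k0 * k2" "v = 1 - k2 * k4"
  have uv_nz: "u \<noteq> 0" "v \<noteq> 0" using k02 k24 by (auto simp: uv)
  define u' where "u' = u / (k0 * k1)"
  \<comment> \<open>The \<sigma>-semilinear part of \<psi> kills z1 and the \<tau>-semilinear part
    kills z2; v and -u' are the factors left on the surviving component.\<close>
  have \<psi>_split: "\<psi> (z1 + z2) = v * \<sigma> z2 - u' * \<tau> z1" if "bar z1 = z1 / c1" "bar z2 = z2 / c2" for z1 z2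
    unfolding \<psi>_def unfolding k_def(3,4)[symmetric] bar_simps that \<sigma>_simps \<tau>_simps c_def \<sigma>k \<tau>k uv u'_def
    using k_nz by (simp add: field_simps)
  have \<psi>x: "\<psi> x = v * \<sigma> x2 - u' * \<tau> x1" and \<psi>y: "\<psi> y = v * \<sigma> y2 - u' * \<tau> y1"
    using \<psi>_split bx1 bx2 by1 by2 by (simp_all add: x y)
  \<comment> \<open>In x * \<psi> y - y * \<psi> x, products of components with equal indices make
    up A, and those with different indices make up d and \<sigma> d.\<close>
  define d where "d = x2 * \<tau> y1 - y2 * \<tau> x1"
  define A where "A = v * (x2 * \<sigma> y2 - y2 * \<sigma> x2) - u' * (x1 * \<tau> y1 - y1 * \<tau> x1)"
  have \<sigma>d: "\<sigma> d = \<sigma> x2 * y1 - \<sigma> y2 * x1" by (simp add: d_def \<sigma>_simps \<sigma>_\<tau>)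
  have sum0: "A - v * \<sigma> d - u' * d = 0"
    using eq unfolding \<psi>x \<psi>y A_def \<sigma>d unfolding d_def x y by (simp add: algebra_simps)
  have bu: "bar u = - u / (k0 * k2)" and bv: "bar v = - v / (k2 * k4)" and bu': "bar u' = - u' * k0 * k1 * k1 / k2"
    using k_nz by (simp_all add: uv u'_def bar_simps bk field_simps)
  have bd: "bar d = d * k3 / (k0 * k1 * k2)"
    unfolding d_def bar_simps bar_\<tau> bx1 bx2 by1 by2 \<tau>_simps c_def \<tau>k
    using k_nz by (simp add: field_simps)
  have bA: "bar A = - A / (k2 * k2)"
    unfolding A_def bar_simps bar_\<tau> bar_\<sigma> bx1 bx2 by1 by2 \<tau>_simps \<sigma>_simps c_def \<tau>k \<sigma>k bu' bv
    using k_nz by (simp add: field_simps)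
  \<comment> \<open>The summands \<open>A\<close>, \<open>v \<sigma> d\<close> and \<open>u' d\<close> lie in three distinct lines over the fixed field of \<open>bar\<close>;
    applying \<open>bar\<close> gives a second linear relation between them.\<close>
  have "bar (A - v * \<sigma> d - u' * d) = 0" using sum0 by (simp add: bar_simps)
  then have "k1 * k3 * A - v * \<sigma> d - u' * (k1 * k3) * (k1 * k3) * d = 0"
    unfolding bar_simps bar_\<sigma> bA bv bu' bd \<sigma>_simps \<sigma>k
    using k_nz by (simp add: field_simps)
  moreover have "A = v * \<sigma> d + u' * d" using sum0 by (simp add: algebra_simps)
  \<comment> \<open>Eliminating A from the two relations leaves this common factor, which is nonzero
    by \<open>k13\<close>.\<close>
  ultimately have "(k1 * k3 - 1) * (v * \<sigma> d - k1 * k3 * u' * d) = 0"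
    by (simp add: algebra_simps)
  with k13 have vd: "v * \<sigma> d = k1 * k3 * u' * d" by simp
  have \<sigma>\<sigma>u: "\<sigma> (\<sigma> u) = v" by (simp add: uv \<sigma>_simps \<sigma>k)
  define w where "w = \<sigma> u"
  have w_nz: "w \<noteq> 0" using uv_nz by (simp add: w_def \<sigma>_simps)
  have bw: "bar w = - w / (k1 * k3)" by (simp add: w_def bar_\<sigma> bu \<sigma>_simps \<sigma>k)
  have \<sigma>w: "\<sigma> w = v" using \<sigma>\<sigma>u by (simp add: w_def)
  have d0: "d = 0"
  proof -
    \<comment> \<open>\<sigma> maps u to w and w to v, so this multiplier absorbs the coefficients
      of \<open>vd\<close> and turns it into \<sigma> g = g.\<close>
    define g where "g = d * u * w / (k0 * k1 * k2)"
    have "\<sigma> g = (v * \<sigma> d) * w / (k1 * k2 * k3)"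
      unfolding g_def \<sigma>_simps \<sigma>k \<sigma>w by (simp flip: w_def)
    also have "\<dots> = g" unfolding vd u'_def g_def using k_nz by (simp add: field_simps)
    finally have "bar g = g" by (rule bar_fixed)
    moreover have "bar g = - g"
      unfolding g_def bar_simps bd bu bw bk using k_nz by (simp add: field_simps)
    ultimately have "g = 0" using neg_eq_self by metis
    then show "d = 0" using k_nz uv_nz w_nz by (simp add: g_def)
  qed
  then have A0: "A = 0" using sum0 by (simp add: \<sigma>_simps)
  show ?thesis
  proof (cases "x1 = 0")
    case True
    then have x2: "x = x2" "x2 \<noteq> 0" using x x0 by auto
    then have "\<tau> y1 = 0" using d0 True by (simp add: d_def \<tau>_simps)
    then have y1: "y1 = 0" by (simp add: \<tau>_simps)
    have "x2 * \<sigma> y2 = y2 * \<sigma> x2"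
      using A0 uv_nz True y1 by (simp add: A_def \<tau>_simps)
    then show ?thesis using x2 y y1 by (simp add: \<sigma>_simps field_simps)
  next
    case False
    then have \<tau>x1: "\<tau> x1 \<noteq> 0" by (simp add: \<tau>_simps)
    \<comment> \<open>d = 0 says that (x2, y2) is proportional to (\<tau> x1, \<tau> y1). After
      substitution both halves of A are multiples of x1 * \<tau> y1 - y1 * \<tau> x1, so A
      factors.\<close>
    define l where "l = x2 / \<tau> x1"
    have x2: "x2 = l * \<tau> x1" using \<tau>x1 by (simp add: l_def)
    have y2: "y2 = l * \<tau> y1" using d0 \<tau>x1 by (simp add: l_def d_def field_simps)
    have "(u' + v * l * \<sigma> l) * (x1 * \<tau> y1 - y1 * \<tau> x1) = - A"
      unfolding A_def x2 y2 \<sigma>_simps \<sigma>_\<tau> by (simp add: algebra_simps)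
    then have "u' + v * l * \<sigma> l = 0 \<or> x1 * \<tau> y1 = y1 * \<tau> x1"
      using A0 by simp
    then show ?thesis
    proof
      assume l: "u' + v * l * \<sigma> l = 0"
      \<comment> \<open>Since \<sigma> (k0 * w / u) = k1 * v / w, this scaling normalises the
        relation for l to g * \<sigma> g = -1.\<close>
      define g where "g = l * k0 * w / u"
      have "g * \<sigma> g = (v * l * \<sigma> l) * (k0 * k1 / u)"
        unfolding g_def \<sigma>_simps \<sigma>k \<sigma>w using w_nz by (simp flip: w_def)
      also have "v * l * \<sigma> l = - u'" using l by (simp add: eq_neg_iff_add_eq_0 add.commute)
      finally have "g * \<sigma> g = - 1" using k_nz uv_nz by (simp add: u'_def)
      moreover have "bar l = l * k0 * k1 * k3 / k2"
        unfolding l_def bar_simps bar_\<tau> bx1 bx2 \<tau>_simps c_def \<tau>k using k_nz by (simp add: field_simps)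
      then have "bar g = - g"
        unfolding g_def bar_simps bu bw bk using k_nz uv_nz by (simp add: field_simps)
      ultimately show ?thesis using no_skew_norm by blast
    next
      assume p: "x1 * \<tau> y1 = y1 * \<tau> x1"
      define c where "c = y1 / x1"
      have y1: "y1 = c * x1" using False by (simp add: c_def)
      have \<tau>c: "\<tau> c = c" using p False \<tau>x1 by (simp add: c_def \<tau>_simps field_simps)
      then have "\<sigma> c = c" by (metis \<sigma>_\<tau>)
      moreover have "y = c * x"
        unfolding x y x2 y2 y1 \<tau>_simps \<tau>c by (simp add: algebra_simps)
      ultimately show ?thesis using x0 by simp
    qed
  qed
qed

end

subsection \<open>Galois groups of finite fields\<close>

lemma primitive_element:
  "\<exists>a::'a::{field,finite}. \<forall>x. x \<noteq> 0 \<longrightarrow> (\<exists>i::nat. x = a ^ i)"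
proof -
  let ?R = "ring_of_type_algebra :: 'a ring"
  interpret R: field ?R by (rule field_from_type_algebra)
  have pow: "a [^]\<^bsub>Multiplicative_Group.mult_of ?R\<^esub> i = a ^ i" for a :: 'a and i :: nat
    by (induction i) (simp_all add: ring_of_type_algebra_def Multiplicative_Group.mult_of_def nat_pow_def mult.commute)
  have "finite (carrier ?R)" by (rule finite_subset[OF subset_UNIV]) simp
  then obtain a where "carrier (Multiplicative_Group.mult_of ?R) = {a [^]\<^bsub>Multiplicative_Group.mult_of ?R\<^esub> i | i::nat. i \<in> UNIV}"
    using R.finite_field_mult_group_has_gen
    unfolding Multiplicative_Group.nat_pow_mult_of by blast
  then have "- {0} = {a ^ i | i::nat. True}"
    unfolding pow by (simp add: ring_of_type_algebra_def Multiplicative_Group.mult_of_def Compl_eq_Diff_UNIV)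
  then show ?thesis by (intro exI[of _ a]) blast
qed

lemma power_CARD_eq_same: "(x :: 'a::{field,finite}) ^ CARD('a) = x"
proof (cases "x = 0")
  case False
  let ?R = "ring_of_type_algebra :: 'a ring"
  interpret R: field ?R by (rule field_from_type_algebra)
  have pow: "a [^]\<^bsub>Multiplicative_Group.mult_of ?R\<^esub> i = a ^ i" for a :: 'a and i :: nat
    by (induction i) (simp_all add: ring_of_type_algebra_def Multiplicative_Group.mult_of_def nat_pow_def mult.commute)
  have carrier: "carrier (Multiplicative_Group.mult_of ?R) = UNIV - {0}"
    by (simp add: ring_of_type_algebra_def Multiplicative_Group.mult_of_def)
  have "x [^]\<^bsub>Multiplicative_Group.mult_of ?R\<^esub> Coset.order (Multiplicative_Group.mult_of ?R) = \<one>\<^bsub>Multiplicative_Group.mult_of ?R\<^esub>"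
    using False carrier by (intro group.pow_order_eq_1[OF R.field_mult_group]) auto
  then have "x ^ (CARD('a) - 1) = 1"
    unfolding pow by (simp add: Coset.order_def carrier card_Diff_singleton ring_of_type_algebra_def Multiplicative_Group.mult_of_def)
  then show ?thesis by (subst power_eq_if) simp
qed (simp add: power_0_left)

text \<open>The elements in question are roots of the nonzero polynomial X^m - X.\<close>

lemma card_power_fixed_le:
  assumes "m > 1"
  shows "card {x :: 'a::{field,finite}. x ^ m = x} \<le> m"
proof -
  let ?p = "Polynomial.monom 1 m - Polynomial.monom 1 1 :: 'a poly"
  have "Polynomial.coeff ?p m = 1" using assms by simp
  then have "?p \<noteq> 0" by (metis coeff_0 zero_neq_one)
  then have "card {x. poly ?p x = 0} \<le> Polynomial.degree ?p" by (rule card_poly_roots_bound)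
  also have "\<dots> \<le> m" using assms by (intro degree_diff_le) (auto intro: order.trans[OF degree_monom_le])
  finally show ?thesis by (simp add: poly_monom)
qed

lemma field_hom_power: "field_hom f \<Longrightarrow> f (x ^ k) = f x ^ k"
  by (induction k) (simp_all add: field_hom_simps)

lemma field_hom_inj: "field_hom f \<Longrightarrow> inj f"
  by (rule injI) (metis field_hom_simps(6,9) eq_iff_diff_eq_0)

text \<open>The characteristic divides the cardinality q^n, so q is a power of it and the freshman's
  dream applies.\<close>

lemma field_hom_card_power:
  assumes "primepow q" and "CARD('a::{field,finite}) = q ^ n"
  shows "field_hom (\<lambda>x :: 'a. x ^ q)"
proof -
  have p: "Factorial_Ring.prime CHAR('a)"
    by (rule prime_CHAR_semidom) (rule finite_imp_CHAR_pos, simp)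
  obtain r k where r: "Factorial_Ring.prime r" "q = r ^ k" using assms(1) by (auto simp: primepow_def)
  have "CHAR('a) dvd q ^ n" using CHAR_dvd_CARD[where 'a='a] assms(2) by simp
  then have "CHAR('a) dvd r" using p r by (metis prime_dvd_power)
  then have "CHAR('a) = r" using p r(1) by (simp add: primes_dvd_imp_eq)
  with freshmans_dream'[where 'a='a, OF p] r show ?thesis
    by (auto simp: field_hom_def power_mult_distrib)
qed

lemma map_poly_linear_prod:
  fixes f :: "'a::field \<Rightarrow> 'a"
  assumes "field_hom f"
  shows "map_poly f (\<Prod>i\<in>I. [:- g i, 1:]) = (\<Prod>i\<in>I. [:- f (g i), 1:])"
proof -
  note f = field_hom_simps[OF assms]
  have sum: "f (\<Sum>i\<in>A. c i) = (\<Sum>i\<in>A. f (c i))" for A :: "nat set" and c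
    by (induction A rule: infinite_finite_induct) (simp_all add: f)
  have mult: "map_poly f (p * r) = map_poly f p * map_poly f r" for p r
    by (rule poly_eqI) (simp add: coeff_map_poly coeff_mult sum f)
  show ?thesis
  proof (induction I rule: infinite_finite_induct)
    case (insert x F)
    then show ?case by (simp add: mult map_poly_pCons f del: mult_pCons_left)
  qed (simp_all add: map_poly_1' f)
qed

text \<open>
  The orbit polynomial of \<open>x\<close> under the Frobenius map has coefficients in the small field,
  so \<open>\<sigma>\<close> permutes its roots.
\<close>
lemma hom_in_frobenius_orbit:
  fixes \<sigma> :: "'a::{field,finite} \<Rightarrow> 'a"
  assumes \<sigma>: "field_hom \<sigma>" and F: "field_hom (\<lambda>x :: 'a. x ^ q)"
    and fixed: "\<And>x. x ^ q = x \<Longrightarrow> \<sigma> x = x"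
    and card: "CARD('a) = q ^ n" and n: "n > 0"
  shows "\<exists>i. \<sigma> x = x ^ (q ^ i)"
proof -
  define p where "p = (\<Prod>i<n. [:- (x ^ (q ^ i)), 1:])"
  have "map_poly (\<lambda>x. x ^ q) p = (\<Prod>i<n. [:- ((x ^ (q ^ i)) ^ q), 1:])"
    unfolding p_def by (rule map_poly_linear_prod[OF F])
  also have "\<dots> = (\<Prod>i<n. [:- (x ^ (q ^ Suc i)), 1:])"
    by (simp add: mult.commute flip: power_mult)
  also have "\<dots> = (\<Prod>i\<in>Suc ` {..<n}. [:- (x ^ (q ^ i)), 1:])"
    by (subst prod.reindex) simp_all
  \<comment> \<open>The Frobenius map shifts the exponents 0, ..., n-1 to 1, ..., n; as x^(q^n) = x,
    the factor for n is the one for 0.\<close>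
  also have "Suc ` {..<n} = insert n ({..<n} - {0})"
    using n by (auto simp: image_Suc_lessThan)
  also have "(\<Prod>i\<in>\<dots>. [:- (x ^ (q ^ i)), 1:]) = [:- x, 1:] * (\<Prod>i\<in>{..<n} - {0}. [:- (x ^ (q ^ i)), 1:])"
    by (subst prod.insert) (simp_all add: power_CARD_eq_same flip: card del: mult_pCons_left)
  also have "\<dots> = p"
    unfolding p_def using n by (subst (2) prod.remove[of _ 0]) (simp_all del: mult_pCons_left)
  finally have "map_poly (\<lambda>x. x ^ q) p = p" .
  then have "Polynomial.coeff p k ^ q = Polynomial.coeff p k" for k
    using field_hom_simps(4)[OF F] by (metis coeff_map_poly)
  then have "\<sigma> (Polynomial.coeff p k) = Polynomial.coeff p k" for k
    using fixed by blast
  then have "p = map_poly \<sigma> p"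
    by (intro poly_eqI) (simp add: coeff_map_poly field_hom_simps(4)[OF \<sigma>])
  also have "\<dots> = (\<Prod>i<n. [:- \<sigma> (x ^ (q ^ i)), 1:])"
    unfolding p_def by (rule map_poly_linear_prod[OF \<sigma>])
  finally have "poly p (\<sigma> x) = 0"
    using n by (auto simp: poly_prod intro!: bexI[of _ 0])
  then show ?thesis
    by (auto simp: p_def poly_prod)
qed

text \<open>The exponent supplied by the orbit lemma depends on the element. Choosing it for a
  generator of the unit group makes it uniform, as \<sigma> is multiplicative.\<close>

lemma field_hom_frobenius_power:
  fixes \<sigma> :: "'a::{field,finite} \<Rightarrow> 'a"
  assumes \<sigma>: "field_hom \<sigma>" and F: "field_hom (\<lambda>x :: 'a. x ^ q)"
    and fixed: "\<And>x. x ^ q = x \<Longrightarrow> \<sigma> x = x"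
    and card: "CARD('a) = q ^ n" and n: "n > 0"
  shows "\<exists>i. \<forall>x. \<sigma> x = x ^ (q ^ i)"
proof -
  obtain a :: 'a where a: "\<And>x. x \<noteq> 0 \<Longrightarrow> \<exists>i::nat. x = a ^ i"
    using primitive_element by blast
  obtain i where i: "\<sigma> a = a ^ (q ^ i)"
    using hom_in_frobenius_orbit[OF assms] by blast
  have "\<sigma> x = x ^ (q ^ i)" for x
  proof (cases "x = 0")
    case True
    \<comment> \<open>For q = 0 the map would send 0 to 0^0 = 1.\<close>
    have "q > 0" using field_hom_simps(4)[OF F] by (rule contrapos_pp) simp
    with True show ?thesis by (simp add: field_hom_simps[OF \<sigma>] power_0_left)
  next
    case False
    then obtain j :: nat where "x = a ^ j" using a by blast
    then show ?thesis by (simp add: field_hom_power[OF \<sigma>] i mult.commute flip: power_mult)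
  qed
  then show ?thesis by blast
qed

section \<open>Generators of the Galois group and their fixed field\<close>

lemma bij_field_hom: "field_hom f \<Longrightarrow> bij (f :: 'a::{field,finite} \<Rightarrow> 'a)"
  using field_hom_inj[of f] finite_UNIV_inj_surj[of f] by (auto simp: bij_def)

lemma galois_group_group:
  "group (galois_group (\<phi> :: 'k::field \<Rightarrow> 'a::{field,finite}))"
proof (rule groupI)
  fix \<tau> assume \<tau>: "\<tau> \<in> carrier (galois_group \<phi>)"
  then have hom: "field_hom \<tau>" and bij: "bij \<tau>" and fixed: "\<And>c. \<tau> (\<phi> c) = \<phi> c"
    by (auto simp: galois_group_def)
  have "inv_into UNIV \<tau> (\<tau> x) = x" "\<tau> (inv_into UNIV \<tau> x) = x" for x
    using bij by (simp_all add: bij_is_inj bij_is_surj surj_f_inv_f)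
  then have "inv_into UNIV \<tau> \<in> carrier (galois_group \<phi>)" "inv_into UNIV \<tau> \<circ> \<tau> = id"
    using hom fixed bij bij_imp_bij_inv[OF bij]
    by (auto simp: galois_group_def field_hom_def fun_eq_iff) metis+
  then show "\<exists>\<rho>\<in>carrier (galois_group \<phi>). \<rho> \<otimes>\<^bsub>galois_group \<phi>\<^esub> \<tau> = \<one>\<^bsub>galois_group \<phi>\<^esub>"
    by (auto simp: galois_group_def)
qed (auto simp: galois_group_def field_hom_def bij_comp)

text \<open>In a finite group nonnegative powers of the generator already exhaust the generated
  subgroup.\<close>

lemma galois_generator_pow:
  fixes \<phi> :: "'k::field \<Rightarrow> 'a::{field,finite}"
  assumes gen: "galois_generator \<phi> \<sigma>" and "\<tau> \<in> carrier (galois_group \<phi>)"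
  shows "\<exists>j. \<tau> = \<sigma> ^^ j"
proof -
  interpret group "galois_group \<phi>" by (rule galois_group_group)
  have "finite (carrier (galois_group \<phi>))"
    by (rule finite_subset[OF subset_UNIV]) simp
  moreover have "\<sigma> \<in> carrier (galois_group \<phi>)" using gen by (simp add: galois_generator_def)
  moreover have "\<sigma> [^]\<^bsub>galois_group \<phi>\<^esub> j = \<sigma> ^^ j" for j :: nat
    by (induction j) (simp_all add: galois_group_def funpow_Suc_right del: funpow.simps(2))
  ultimately have "generate (galois_group \<phi>) {\<sigma>} = {\<sigma> ^^ j | j. True}"
    by (simp add: generate_pow_on_finite_carrier)
  with assms show ?thesis by (auto simp: galois_generator_def)
qed

text \<open>The image of \<phi> consists of q roots of X^q - X, and there are at most q
  roots.\<close>

lemma power_fixed_eq_range: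
  fixes \<phi> :: "'k::{field,finite} \<Rightarrow> 'a::{field,finite}"
  assumes q: "primepow q" "CARD('k) = q" and \<phi>: "field_hom \<phi>"
  shows "range \<phi> = {x. x ^ q = x}"
proof (rule card_seteq)
  have q1: "q > 1" using primepow_gt_Suc_0[OF q(1)] by simp
  show "card {x :: 'a. x ^ q = x} \<le> card (range \<phi>)"
    using card_power_fixed_le[OF q1, where 'a='a] q(2) field_hom_inj[OF \<phi>]
    by (simp add: card_image)
  show "range \<phi> \<subseteq> {x. x ^ q = x}"
    by (auto simp: power_CARD_eq_same simp flip: field_hom_power[OF \<phi>] q(2))
qed simp

text \<open>\<sigma> is the i-th power of the Frobenius map F, and F is a power of \<sigma>, so
  elements fixed by \<sigma> are fixed by F. If i were even, \<sigma>^t and hence F^t would be the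
  identity, giving X^(q^t) - X too many roots. So i is odd, and \<sigma>^t = F^t because F^(2t) is
  the identity.\<close>

lemma galois_generator_facts:
  fixes \<phi> :: "'k::{field,finite} \<Rightarrow> 'a::{field,finite}"
  assumes q: "primepow q" "CARD('k) = q" and card: "CARD('a) = q ^ (2 * t)" and t: "t > 0"
    and \<phi>: "field_hom \<phi>" and gen: "galois_generator \<phi> \<sigma>"
  shows "field_hom \<sigma>" and "bij \<sigma>" and "\<sigma> (\<phi> c) = \<phi> c"
    and "\<sigma> x = x \<Longrightarrow> x ^ q = x" and "(\<sigma> ^^ t) x = x ^ (q ^ t)"
proof -
  show hom: "field_hom \<sigma>" and "bij \<sigma>" and fixed\<phi>: "\<sigma> (\<phi> c) = \<phi> c" for c
    using gen by (auto simp: galois_generator_def galois_group_def)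
  have q1: "q > 1" using primepow_gt_Suc_0[OF q(1)] by simp
  have F: "field_hom (\<lambda>x :: 'a. x ^ q)" using field_hom_card_power[OF q(1) card] .
  have range: "range \<phi> = {x. x ^ q = x}" by (rule power_fixed_eq_range[OF q \<phi>])
  then have fixed: "\<sigma> x = x" if "x ^ q = x" for x
    using that fixed\<phi> by (metis (mono_tags) imageE mem_Collect_eq)
  obtain i where i: "\<And>x. \<sigma> x = x ^ (q ^ i)"
    using field_hom_frobenius_power[OF hom F fixed card] t by auto
  have \<sigma>pow: "(\<sigma> ^^ k) x = x ^ (q ^ (i * k))" for k x
    by (induction k) (simp_all add: i power_add mult.commute flip: power_mult)
  have Fpow: "((\<lambda>x. x ^ q) ^^ k) x = x ^ (q ^ k)" for k and x :: 'a
    by (induction k) (simp_all add: mult.commute flip: power_mult)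
  have "(\<lambda>x. x ^ q) \<in> carrier (galois_group \<phi>)"
    using F bij_field_hom[OF F] by (simp add: galois_group_def) (use range in blast)
  then obtain j where j: "(\<lambda>x. x ^ q) = \<sigma> ^^ j"
    using galois_generator_pow[OF gen] by blast
  show "x ^ q = x" if "\<sigma> x = x" for x
  proof -
    have "(\<sigma> ^^ j) x = x" using that by (induction j) simp_all
    then show ?thesis by (simp flip: j)
  qed
  have "y ^ (CARD('a) ^ m) = y" for y :: 'a and m
    by (induction m) (simp_all add: power_mult power_CARD_eq_same)
  then have period: "y ^ (q ^ (2 * t * m)) = y" for y :: 'a and m
    by (simp only: card power_mult)
  have "odd i"
  proof
    assume "even i"
    then obtain m where m: "i = 2 * m" by (elim evenE)
    have \<sigma>t: "\<sigma> ^^ t = id"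
      using period[of _ m] by (auto simp: \<sigma>pow m fun_eq_iff mult_ac)
    have "x ^ (q ^ t) = x" for x :: 'a
    proof -
      have "x ^ (q ^ t) = ((\<sigma> ^^ j) ^^ t) x" by (simp flip: j add: Fpow)
      also have "(\<sigma> ^^ j) ^^ t = (\<sigma> ^^ t) ^^ j" by (simp add: funpow_mult mult.commute)
      finally show ?thesis by (simp add: \<sigma>t)
    qed
    then have "CARD('a) \<le> q ^ t"
      using card_power_fixed_le[OF one_less_power[OF q1 t], where 'a='a] by simp
    moreover have "q ^ t < q ^ (2 * t)" using q1 t by simp
    ultimately show False using card by simp
  qed
  then obtain m where "i = 2 * m + 1" by (elim oddE)
  then have "(\<sigma> ^^ t) x = (x ^ (q ^ (2 * t * m))) ^ (q ^ t)" for x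
    by (simp add: \<sigma>pow algebra_simps power_add flip: power_mult)
  then show "(\<sigma> ^^ t) x = x ^ (q ^ t)" for x by (simp add: period)
qed

subsection \<open>Rank and minimum distance\<close>

lemma (in vector_space) card_subspace:
  fixes V :: "'b set"
  assumes V: "subspace V" and fin: "finite V" and fin': "finite (UNIV :: 'a set)"
  shows "card V = CARD('a) ^ dim V"
proof -
  obtain B where B: "B \<subseteq> V" "independent B" "V \<subseteq> span B" "card B = dim V"
    using basis_exists by blast
  have finB: "finite B" using B(1) fin by (rule finite_subset)
  let ?f = "\<lambda>u. \<Sum>v\<in>B. scale (u v) v"
  have "V = span B" using B(1,3) V by (simp add: span_minimal subset_antisym)
  also have "\<dots> = ?f ` (B \<rightarrow>\<^sub>E UNIV)"
  proof -
    \<comment> \<open>Cutting coordinate functions down to B makes them unique, so that they can be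
      counted.\<close>
    have "?f u \<in> ?f ` (B \<rightarrow>\<^sub>E UNIV)" for u
      by (rule image_eqI[of _ _ "restrict u B"]) (auto intro: sum.cong)
    then show ?thesis by (auto simp: span_finite[OF finB])
  qed
  also have "card \<dots> = card (B \<rightarrow>\<^sub>E (UNIV :: 'a set))"
  proof (intro card_image inj_onI)
    fix u w assume uw: "u \<in> B \<rightarrow>\<^sub>E UNIV" "w \<in> B \<rightarrow>\<^sub>E UNIV" and eq: "?f u = ?f w"
    have "(\<Sum>v\<in>B. scale (u v - w v) v) = 0"
      using eq by (simp add: scale_left_diff_distrib sum_subtractf)
    then have "u v - w v = 0" if "v \<in> B" for v
      using independentD[OF B(2) finB subset_refl, of "\<lambda>v. u v - w v"] that by simp
    then show "u = w" using uw by (intro PiE_ext) auto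
  qed
  finally show ?thesis by (simp add: card_PiE[OF finB] B(4))
qed

lemma vector_space_field_hom:
  "field_hom \<phi> \<Longrightarrow> vector_space (\<lambda>c x. \<phi> c * x :: 'a::field)"
  by unfold_locales (simp_all add: field_hom_simps algebra_simps)

lemma card_range_eq_power_rk:
  fixes \<phi> :: "'k::{field,finite} \<Rightarrow> 'a::{field,finite}"
  assumes \<phi>: "field_hom \<phi>"
    and add: "\<And>x y. f (x + y) = f x + f y" and scale: "\<And>c x. f (\<phi> c * x) = \<phi> c * f x"
  shows "card (range f) = CARD('k) ^ rk \<phi> f"
proof -
  interpret vector_space "\<lambda>c x. \<phi> c * x :: 'a" by (rule vector_space_field_hom[OF \<phi>])
  have "f 0 = 0" using scale[of 0 0] by (simp add: field_hom_simps[OF \<phi>])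
  then have "subspace (range f)"
    unfolding subspace_def using add scale by (auto simp: image_iff) metis+
  then show ?thesis unfolding rk_def by (rule card_subspace) simp_all
qed

text \<open>Each fibre over a point of the range is a translate of the kernel.\<close>

lemma card_range_times_card_kernel:
  fixes f :: "'a::{ab_group_add,finite} \<Rightarrow> 'b::ab_group_add"
  assumes add: "\<And>x y. f (x + y) = f x + f y"
  shows "card (range f) * card {x. f x = 0} = CARD('a)"
proof -
  have diff: "f (x - y) = f x - f y" for x y
    using add[of "x - y" y] by (simp add: algebra_simps)
  have fibre: "card (f -` {y}) = card {x. f x = 0}" if y: "y \<in> range f" for y
  proof -
    obtain x0 where "y = f x0" using y by blast
    then have "bij_betw (\<lambda>x. x + x0) {x. f x = 0} (f -` {y})"
      by (intro bij_betwI[where g = "\<lambda>x. x - x0"]) (auto simp: add diff)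
    then show ?thesis by (simp add: bij_betw_same_card)
  qed
  have "CARD('a) = card (\<Union>y\<in>range f. f -` {y})" by (rule arg_cong[where f = card]) auto
  also have "\<dots> = (\<Sum>y\<in>range f. card (f -` {y}))"
    by (rule card_UN_disjoint) auto
  finally show ?thesis by (simp add: fibre)
qed

section \<open>From a scattered map to an MRD code\<close>

lemma module_fun: "Modules.module (\<lambda>(a :: 'a::field) f (x :: 'b). a * f x)"
  by unfold_locales (simp_all add: fun_eq_iff algebra_simps)

lemma psi_code_eq: "psi_code h t \<sigma> = {\<lambda>x. a * x + b * psi h t \<sigma> x | a b. True}"
proof -
  interpret Modules.module "\<lambda>(a :: 'a) f (x :: 'a). a * f x" by (rule module_fun)
  show ?thesis
    unfolding psi_code_def span_insert span_singleton
    by (auto simp: fun_eq_iff image_iff algebra_simps)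
qed

text \<open>Scatteredness puts each kernel of a nonzero a x + b \<psi> x inside one line over the
  small field, so the rank is at least n - 1. The code has q^(2n) elements, which matches the bound
  for distance n - 1 once this rank is attained.\<close>

lemma MRD_code_of_scattered:
  fixes \<phi> :: "'k::{field,finite} \<Rightarrow> 'a::{field,finite}" and \<psi> :: "'a \<Rightarrow> 'a"
  assumes \<phi>: "field_hom \<phi>" and card: "CARD('a) = CARD('k) ^ n" and n: "n \<ge> 2"
    and add: "\<And>x y. \<psi> (x + y) = \<psi> x + \<psi> y" and scale: "\<And>c x. \<psi> (\<phi> c * x) = \<phi> c * \<psi> x"
    and scattered: "\<And>x y. x \<noteq> 0 \<Longrightarrow> x * \<psi> y = y * \<psi> x \<Longrightarrow> y / x \<in> range \<phi>"
    and C: "C = {\<lambda>x. a * x + b * \<psi> x | a b. True}" and sub: "C \<subseteq> sigma_polys \<sigma> n"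
  shows "MRD_code \<phi> \<sigma> n C"
proof -
  let ?q = "CARD('k)"
  define F where "F a b = (\<lambda>x. a * x + b * \<psi> x)" for a b
  have q: "?q > 1" using card_mono[of UNIV "{0, 1 :: 'k}"] by simp
  have F_add: "F a b (x + y) = F a b x + F a b y" for a b x y
    by (simp add: F_def add algebra_simps)
  have F_scale: "F a b (\<phi> c * x) = \<phi> c * F a b x" for a b c x
    by (simp only: F_def scale) (simp add: algebra_simps)
  have card_\<phi>: "card (range \<phi>) = ?q" by (simp add: card_image field_hom_inj[OF \<phi>])
  have prod: "?q ^ rk \<phi> (F a b) * card {x. F a b x = 0} = ?q ^ n" for a b
    using card_range_times_card_kernel[of "F a b", OF F_add]
      card_range_eq_power_rk[OF \<phi>, of "F a b", OF F_add F_scale] card by simp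
  have kernel: "card {x. F a b x = 0} \<le> ?q" if ab: "(a, b) \<noteq> (0, 0)" for a b
  proof (cases "\<exists>x. x \<noteq> 0 \<and> F a b x = 0")
    case True
    then obtain x where x: "x \<noteq> 0" "F a b x = 0" by blast
    have b: "b \<noteq> 0" using x ab by (auto simp: F_def)
    have "{y. F a b y = 0} \<subseteq> (\<lambda>c. c * x) ` range \<phi>"
    proof
      fix y assume "y \<in> {y. F a b y = 0}"
      then have y: "a * y + b * \<psi> y = 0" and x': "a * x + b * \<psi> x = 0" using x by (simp_all add: F_def)
      \<comment> \<open>Eliminates a from the two kernel equations.\<close>
      have "b * (x * \<psi> y - y * \<psi> x) = x * (a * y + b * \<psi> y) - y * (a * x + b * \<psi> x)"
        by (simp add: algebra_simps)
      then have "x * \<psi> y = y * \<psi> x" using b by (simp add: y x')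
      then have "y / x \<in> range \<phi>" by (rule scattered[OF x(1)])
      then show "y \<in> (\<lambda>c. c * x) ` range \<phi>" using x(1) by (intro image_eqI[of _ _ "y / x"]) simp_all
    qed
    then have "card {y. F a b y = 0} \<le> card ((\<lambda>c. c * x) ` range \<phi>)" by (intro card_mono) simp_all
    also have "\<dots> \<le> ?q" using card_image_le[of "range \<phi>"] card_\<phi> by simp
    finally show ?thesis .
  next
    case False
    then have "{x. F a b x = 0} \<subseteq> {0}" by auto
    then have "card {x. F a b x = 0} \<le> card {0 :: 'a}" by (intro card_mono) simp_all
    with q show ?thesis by simp
  qed
  have rk_ge: "n - 1 \<le> rk \<phi> (F a b)" if "(a, b) \<noteq> (0, 0)" for a b
  proof -
    have "?q ^ n \<le> ?q ^ rk \<phi> (F a b) * ?q"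
      using prod[of a b] kernel[OF that] by (metis mult_le_mono2)
    then have "?q ^ n \<le> ?q ^ Suc (rk \<phi> (F a b))" by (simp add: mult.commute)
    then have "n \<le> Suc (rk \<phi> (F a b))" using q by (rule power_le_imp_le_exp[rotated])
    then show ?thesis by simp
  qed
  have F_inj: "(a, b) = (a', b')" if "F a b = F a' b'" for a b a' b'
  proof (rule ccontr)
    assume "(a, b) \<noteq> (a', b')"
    then have ne: "(a - a', b - b') \<noteq> (0, 0)" by simp
    \<comment> \<open>Equal maps would make the kernel of the difference the whole field, which has
      more than q elements.\<close>
    have "F (a - a') (b - b') x = F a b x - F a' b' x" for x
      by (simp add: F_def algebra_simps)
    then have "{x. F (a - a') (b - b') x = 0} = UNIV" using that by simp
    then have "?q ^ n \<le> ?q ^ 1" using kernel[OF ne] card by simp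
    then have "n \<le> 1" using q by (rule power_le_imp_le_exp[rotated])
    with n show False by simp
  qed
  have C_eq: "C = (\<lambda>(a, b). F a b) ` UNIV" unfolding C F_def by auto
  have "card C = card (UNIV :: ('a \<times> 'a) set)"
    unfolding C_eq by (intro card_image inj_onI) (auto dest: F_inj)
  also have "\<dots> = ?q ^ (n * 2)"
    by (simp add: card card_cartesian_product power_mult power2_eq_square flip: UNIV_Times_UNIV)
  finally have card_C: "card C = ?q ^ (n * 2)" .
  have diff: "F a b - F a' b' = F (a - a') (b - b')" for a b a' b'
    by (simp add: fun_eq_iff F_def algebra_simps)
  have "min_distance \<phi> C = n - 1"
    unfolding min_distance_def
  proof (rule Min_eqI)
    show "finite {rk \<phi> (f - g) |f g. f \<in> C \<and> g \<in> C \<and> f \<noteq> g}"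
      by (rule finite_subset[of _ "(\<lambda>(f, g). rk \<phi> (f - g)) ` UNIV"]) auto
    show "n - 1 \<le> r" if "r \<in> {rk \<phi> (f - g) |f g. f \<in> C \<and> g \<in> C \<and> f \<noteq> g}" for r
    proof -
      from that obtain a b a' b' where "r = rk \<phi> (F a b - F a' b')" "F a b \<noteq> F a' b'"
        unfolding C_eq by auto
      moreover from this have "(a - a', b - b') \<noteq> (0, 0)" by auto
      ultimately show ?thesis using rk_ge by (simp add: diff)
    qed
    \<comment> \<open>The codeword \<psi> x - \<psi>(1) x vanishes on the image of \<phi>, so its
      rank is at most n - 1.\<close>
    let ?m = "- \<psi> 1"
    have "range \<phi> \<subseteq> {x. F ?m 1 x = 0}"
      using scale[of _ 1] by (auto simp: F_def)
    then have "?q \<le> card {x. F ?m 1 x = 0}"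
      using card_mono[of "{x. F ?m 1 x = 0}" "range \<phi>"] card_\<phi> by simp
    then have "?q ^ rk \<phi> (F ?m 1) * ?q \<le> ?q ^ n"
      using prod[of ?m 1] by (metis mult_le_mono2)
    then have "?q ^ Suc (rk \<phi> (F ?m 1)) \<le> ?q ^ n" by (simp add: mult.commute)
    then have "Suc (rk \<phi> (F ?m 1)) \<le> n" using q by (rule power_le_imp_le_exp[rotated])
    then have "n - 1 = rk \<phi> (F ?m 1 - F 0 0)" using rk_ge[of ?m 1] by (simp add: diff)
    moreover have "F ?m 1 \<noteq> F 0 0" using F_inj[of ?m 1 0 0] by auto
    ultimately show "n - 1 \<in> {rk \<phi> (f - g) |f g. f \<in> C \<and> g \<in> C \<and> f \<noteq> g}"
      unfolding C_eq by auto
  qed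
  then have "n - min_distance \<phi> C + 1 = 2" using n by simp
  then show ?thesis unfolding MRD_code_def using sub card_C by (simp only: simp_thms)
qed

lemma psi_code_sigma_polys:
  assumes "t \<ge> 3"
  shows "psi_code h t \<sigma> \<subseteq> sigma_polys \<sigma> (2 * t)"
proof
  fix f assume "f \<in> psi_code h t \<sigma>"
  then obtain a b where f: "f = (\<lambda>x. a * x + b * psi h t \<sigma> x)" unfolding psi_code_eq by blast
  define s where "s = h * inv_into UNIV \<sigma> (inverse h)"
  define c where "c i = (if i = 0 then a else if i = 1 \<or> i = t - 1 then b
    else if i = t + 1 then b * (h * \<sigma> h) else if i = 2 * t - 1 then b * s else 0)" for i
  have "f x = (\<Sum>i<2 * t. c i * (\<sigma> ^^ i) x)" for x
  proof -
    have "(\<Sum>i<2 * t. c i * (\<sigma> ^^ i) x) = (\<Sum>i\<in>{0, 1, t - 1, t + 1, 2 * t - 1}. c i * (\<sigma> ^^ i) x)"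
      using assms by (intro sum.mono_neutral_right) (auto simp: c_def)
    also have "\<dots> = f x"
    proof -
      \<comment> \<open>Here t \<ge> 3 matters: for t = 2 the exponents 1 and t - 1 coincide, and so
        do t + 1 and 2t - 1.\<close>
      have "0 \<noteq> t - 1" "1 \<noteq> t - 1" "0 \<noteq> 2 * t - 1" "1 \<noteq> t + 1" "1 \<noteq> 2 * t - 1" "t - 1 \<noteq> t + 1"
        "t - 1 \<noteq> 2 * t - 1" "t + 1 \<noteq> 2 * t - 1"
        using assms by auto
      then show ?thesis
        by (simp add: c_def f psi_def algebra_simps flip: s_def)
    qed
    finally show ?thesis by simp
  qed
  then show "f \<in> sigma_polys \<sigma> (2 * t)" unfolding sigma_polys_def by blast
qed

section \<open>Specialisation to the code of \<open>psi\<close>\<close>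

theorem theorem3p8:
  fixes \<phi> :: "'k::{field,finite} \<Rightarrow> 'a::{field,finite}"
    and \<sigma> :: "'a \<Rightarrow> 'a"
    and h :: 'a
    and n t q :: nat
  assumes "n = 2 * t" and "t \<ge> 3"
    and "primepow q" and "odd q"
    and "CARD('k) = q" and "CARD('a) = q ^ n"
    and "field_hom \<phi>"
    and "galois_generator \<phi> \<sigma>"
    and "rel_norm q t h = - 1"
  shows "MRD_code \<phi> \<sigma> n (psi_code h t \<sigma>)"
proof -
  note facts = galois_generator_facts[OF assms(3,5) assms(6)[unfolded assms(1)] _ assms(7,8)]
  have t: "t > 0" using assms(2) by simp
  note hom = facts(1)[OF t] and bij = facts(2)[OF t] and fixes_\<phi> = facts(3)[OF t]
    and fixed = facts(4)[OF t] and \<sigma>t = facts(5)[OF t]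
  let ?\<tau> = "inv_into UNIV \<sigma>"
  have inv: "\<sigma> (?\<tau> x) = x" "?\<tau> (\<sigma> x) = x" for x
    using bij by (simp_all add: bij_is_inj bij_is_surj surj_f_inv_f)
  have bar_bar: "(\<sigma> ^^ t) ((\<sigma> ^^ t) x) = x" for x
    using power_CARD_eq_same[of x] assms(1,6)
    by (simp add: \<sigma>t mult_2 flip: power_mult power_add)
  \<comment> \<open>The characteristic divides the odd number q^n, so it is not 2.\<close>
  have two: "(1 :: 'a) \<noteq> - 1"
  proof
    assume "(1 :: 'a) = - 1"
    then have "(of_nat 2 :: 'a) = 0" by (simp add: eq_neg_iff_add_eq_0)
    then have "CHAR('a) dvd 2" by (simp only: of_nat_eq_0_iff_char_dvd)
    moreover have "CHAR('a) \<noteq> 1" using of_nat_eq_0_iff_char_dvd[of 1, where 'a='a] by auto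
    moreover have "odd CHAR('a)"
      using CHAR_dvd_CARD[where 'a='a] assms(4,6) by (metis dvd_trans even_power)
    ultimately show False by (metis dvd_refl prime_nat_iff two_is_prime_nat)
  qed
  interpret involution_setup \<sigma> ?\<tau> t h
    by unfold_locales (use hom inv bar_bar two \<sigma>t assms(9) in \<open>simp_all add: rel_norm_def\<close>)
  have psi: "psi h t \<sigma> = \<psi>"
  proof
    fix x
    \<comment> \<open>Raising the exponent by one removes the truncated subtractions in t - 1 and 2t
      - 1.\<close>
    have \<tau>_pow: "(\<sigma> ^^ k) x = ?\<tau> ((\<sigma> ^^ Suc k) x)" for k by (simp add: inv)
    have "(\<sigma> ^^ (t - 1)) x = ?\<tau> (bar x)" using t by (subst \<tau>_pow) simp
    moreover have "(\<sigma> ^^ (2 * t - 1)) x = ?\<tau> x"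
      using t bar_bar[of x] by (subst \<tau>_pow) (simp del: funpow.simps add: mult_2 funpow_add)
    ultimately show "psi h t \<sigma> x = \<psi> x" by (simp add: psi_def \<psi>_def)
  qed
  have range_\<phi>: "x \<in> range \<phi>" if "\<sigma> x = x" for x
  proof -
    have "range \<phi> = {x. x ^ q = x}" using power_fixed_eq_range[OF assms(3,5,7)] .
    with fixed[OF that] show ?thesis by simp
  qed
  show ?thesis
  proof (rule MRD_code_of_scattered[OF assms(7)])
    show "CARD('a) = CARD('k) ^ n" using assms by simp
    show "n \<ge> 2" using assms by simp
    show "\<psi> (x + y) = \<psi> x + \<psi> y" for x y
      by (simp add: \<psi>_def \<sigma>_simps \<tau>_simps bar_simps algebra_simps)
    have "?\<tau> (\<phi> c) = \<phi> c" "bar (\<phi> c) = \<phi> c" for c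
      using fixes_\<phi>[of c] inv(2)[of "\<phi> c"] bar_fixed by simp_all
    then show "\<psi> (\<phi> c * x) = \<phi> c * \<psi> x" for c x
      by (simp add: \<psi>_def \<sigma>_simps \<tau>_simps bar_simps fixes_\<phi> algebra_simps)
    show "y / x \<in> range \<phi>" if "x \<noteq> 0" "x * \<psi> y = y * \<psi> x" for x y
      using scattered[OF that] by (rule range_\<phi>)
    show "psi_code h t \<sigma> = {\<lambda>x. a * x + b * \<psi> x |a b. True}"
      by (simp add: psi_code_eq psi)
    show "psi_code h t \<sigma> \<subseteq> sigma_polys \<sigma> n"
      using psi_code_sigma_polys[OF assms(2)] assms(1) by simp
  qed
qed

end
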